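(* Let $M\ge 1$ users and the average SNR functions $\bar\Gamma_m:[0,D_x]\to(0,\infty)$, $m\in\{1,\dots,M\}$, be as defined in the context, i.e. $\bar\Gamma_m(\tilde x)=\rho_m\,\dfrac{\eta e^{-\beta r_m^2(\tilde x)}+\mu_m^2}{r_m^2(\tilde x)}$ with $r_m^2(\tilde x)=(x_m-\tilde x)^2+C_m$. For each user $m$ and each target level $t>0$, the set $$\mathcal I_m(t)\triangleq\{\tilde x\in[0,D_x]:\bar\Gamma_m(\tilde x)\ge t\}$$ is either a closed interval or empty. Consequently, the set $$\mathcal F(t)\triangleq\bigcap_{m=1}^M\mathcal I_m(t)$$ is also either a closed interval or empty. Moreover, $\mathcal F(t)$ monotonically shrinks as $t$ increases: for all $t_1,t_2>0$, $$t_1<t_2\ \Longrightarrow\ \mathcal F(t_1)\supseteq\mathcal F(t_2).$$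
   Context: Parameters: $D_x>0$, $D_y>0$ (dimensions of the service region), $d_v>0$ (waveguide height), $\eta>0$, $0\le\beta\le1$, and for each user $m\in\{1,\dots,M\}$: $\rho_m>0$ (transmit SNR scaling factor), $\mu_m^2\ge0$ (NLoS power), and a position $(x_m,y_m)$ with $0\le x_m\le D_x$ and $-D_y/2\le y_m\le D_y/2$. The antenna is located at $(\tilde x,0,d_v)$ with $\tilde x\in[0,D_x]$. Set $C_m\triangleq y_m^2+d_v^2>0$, and let $r_m(\tilde x)>0$ be the distance from user $m$ (at $(x_m,y_m,0)$) to the antenna, so $r_m^2(\tilde x)=(x_m-\tilde x)^2+C_m$. The average SNR of user $m$ is $$\bar\Gamma_m(\tilde x)=\rho_m\,\frac{\eta e^{-\beta r_m^2(\tilde x)}+\mu_m^2}{r_m^2(\tilde x)}.$$ A closed interval is a set $[a,b]$ with $a\le b$ (a single point is allowed). *)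

theory Defs
  imports "HOL-Analysis.Analysis"
begin

(* The metric on real \<times> real \<times> real is the Euclidean one: each product
   carries the square root of the sum of the squared component distances. *)
definition user_dist :: "real \<Rightarrow> real \<Rightarrow> real \<Rightarrow> real \<Rightarrow> real" where
  "user_dist d_v x y xt = dist (x, y, 0::real) (xt, 0::real, d_v)"

(* The NLoS power enters as mu^2 and may therefore vanish. *)
definition avg_snr ::
  "real \<Rightarrow> real \<Rightarrow> real \<Rightarrow> real \<Rightarrow> real \<Rightarrow> real \<Rightarrow> real \<Rightarrow> real \<Rightarrow> real" where
  "avg_snr \<eta> \<beta> d_v \<rho> \<mu> x y xt =
     \<rho> * ((\<eta> * exp (- \<beta> * (user_dist d_v x y xt)\<^sup>2) + \<mu>\<^sup>2) / (user_dist d_v x y xt)\<^sup>2)"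

definition snr_set ::
  "real \<Rightarrow> real \<Rightarrow> real \<Rightarrow> real \<Rightarrow> real \<Rightarrow> real \<Rightarrow> real \<Rightarrow> real \<Rightarrow> real \<Rightarrow> real set" where
  "snr_set D_x \<eta> \<beta> d_v \<rho> \<mu> x y t =
     {xt \<in> {0..D_x}. avg_snr \<eta> \<beta> d_v \<rho> \<mu> x y xt \<ge> t}"

definition feasible_set ::
  "real \<Rightarrow> real \<Rightarrow> real \<Rightarrow> real \<Rightarrow> nat \<Rightarrow> (nat \<Rightarrow> real) \<Rightarrow> (nat \<Rightarrow> real) \<Rightarrow>
    (nat \<Rightarrow> real) \<Rightarrow> (nat \<Rightarrow> real) \<Rightarrow> real \<Rightarrow> real set" where
  "feasible_set D_x \<eta> \<beta> d_v M \<rho> \<mu> x y t =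
     (\<Inter>m\<in>{1..M}. snr_set D_x \<eta> \<beta> d_v (\<rho> m) (\<mu> m) (x m) (y m) t)"

(* A single point counts as a closed interval, the empty set does not. *)
definition is_closed_interval :: "real set \<Rightarrow> bool" where
  "is_closed_interval S \<longleftrightarrow> (\<exists>a b. a \<le> b \<and> S = {a..b})"

lemma user_dist_squared: "(user_dist d_v x y xt)\<^sup>2 = (x - xt)\<^sup>2 + (y\<^sup>2 + d_v\<^sup>2)"
  by (simp add: user_dist_def dist_prod_def dist_real_def)

lemma avg_snr_pos:
  assumes "d_v > 0" "\<eta> > 0" "\<rho> > 0"
  shows "avg_snr \<eta> \<beta> d_v \<rho> \<mu> x y xt > 0"
proof -
  have "(user_dist d_v x y xt)\<^sup>2 > 0"
    using assms(1) by (simp add: user_dist_squared add_nonneg_pos)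
  moreover have "\<eta> * exp (- \<beta> * (user_dist d_v x y xt)\<^sup>2) + \<mu>\<^sup>2 > 0"
    using assms(2) by (simp add: add_pos_nonneg)
  ultimately show ?thesis
    unfolding avg_snr_def using assms(3) by (metis divide_pos_pos mult_pos_pos)
qed

end

theory Submission
  imports Defs
begin

text \<open>The squared distance \<open>(x - u)\<^sup>2 + y\<^sup>2 + d_v\<^sup>2\<close> depends on
  the antenna position u only through \<open>\<bar>x - u\<bar>\<close>. As it grows, the numerator
  of the SNR does not increase and the denominator does not decrease, so the SNR is unimodal with
  its peak at u = x (\<open>avg_snr_antimono_dist\<close>). Its superlevel sets are therefore convex
  (\<open>convex_snr_set\<close>), and by continuity they are compact inside \<open>{0..D_x}\<close>
  (\<open>compact_snr_set\<close>). On the real line, convex and compact together mean closed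
  interval or empty, and both properties survive intersection, which settles the feasible set.
  Shrinking in t holds for each superlevel set and passes to the intersection.\<close>

text \<open>Replaces the search for endpoints by two properties that are stable under intersection.
  It rests on the fact that connected compact subsets of the line are exactly the sets
  \<open>{a..b}\<close>.\<close>

lemma closed_interval_or_empty_iff:
  "is_closed_interval S \<or> S = {} \<longleftrightarrow> convex S \<and> compact S"
proof -
  have "is_closed_interval S \<or> S = {} \<longleftrightarrow> (\<exists>a b. S = {a..b})"
  proof
    show "\<exists>a b. S = {a..b}" if "is_closed_interval S \<or> S = {}"
      using that unfolding is_closed_interval_def
      \<comment> \<open>The empty set is written as the reversed interval
        \<open>{1..0}\<close>.\<close>
      by (metis atLeastatMost_empty zero_less_one)
    show "is_closed_interval S \<or> S = {}" if "\<exists>a b. S = {a..b}"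
      using that unfolding is_closed_interval_def by force
  qed
  then show ?thesis
    by (simp only: connected_compact_interval_1 [symmetric] connected_convex_1)
qed

lemma avg_snr_antimono_dist:
  assumes "d_v > 0" "\<eta> \<ge> 0" "\<beta> \<ge> 0" "\<rho> \<ge> 0" and le: "\<bar>x - u\<bar> \<le> \<bar>x - v\<bar>"
  shows "avg_snr \<eta> \<beta> d_v \<rho> \<mu> x y v \<le> avg_snr \<eta> \<beta> d_v \<rho> \<mu> x y u"
proof -
  have pos: "0 < (user_dist d_v x y u)\<^sup>2"
    using assms(1) by (simp add: user_dist_squared add_nonneg_pos)
  have dist_le: "(user_dist d_v x y u)\<^sup>2 \<le> (user_dist d_v x y v)\<^sup>2"
    using le by (simp add: user_dist_squared abs_le_square_iff)
  have "\<eta> * exp (- \<beta> * (user_dist d_v x y v)\<^sup>2) + \<mu>\<^sup>2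
      \<le> \<eta> * exp (- \<beta> * (user_dist d_v x y u)\<^sup>2) + \<mu>\<^sup>2"
    using dist_le assms by (simp add: mult_left_mono)
  then show ?thesis
    unfolding avg_snr_def using pos dist_le assms
    by (intro mult_left_mono frac_le add_nonneg_nonneg mult_nonneg_nonneg) auto
qed

text \<open>The positive height \<open>d_v\<close> keeps the antenna off the user's plane, so the
  denominator never vanishes.\<close>

lemma continuous_on_avg_snr:
  assumes "d_v > 0"
  shows "continuous_on A (avg_snr \<eta> \<beta> d_v \<rho> \<mu> x y)"
proof -
  have "(x - u)\<^sup>2 + (y\<^sup>2 + d_v\<^sup>2) \<noteq> 0" for u
    using assms by (simp add: add_nonneg_pos less_imp_neq[symmetric])
  then show ?thesis
    unfolding avg_snr_def user_dist_squared by (intro continuous_intros) auto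
qed

lemma compact_snr_set:
  assumes "d_v > 0"
  shows "compact (snr_set D_x \<eta> \<beta> d_v \<rho> \<mu> x y t)"
proof -
  have "closed {u. t \<le> avg_snr \<eta> \<beta> d_v \<rho> \<mu> x y u}"
    using assms by (intro closed_Collect_le continuous_on_const continuous_on_avg_snr)
  then have "compact ({0..D_x} \<inter> {u. t \<le> avg_snr \<eta> \<beta> d_v \<rho> \<mu> x y u})"
    by (intro compact_Int_closed compact_Icc)
  then show ?thesis
    by (simp add: snr_set_def Int_def)
qed

lemma convex_snr_set:
  assumes "d_v > 0" "\<eta> \<ge> 0" "\<beta> \<ge> 0" "\<rho> \<ge> 0"
  shows "convex (snr_set D_x \<eta> \<beta> d_v \<rho> \<mu> x y t)"
  unfolding is_interval_convex_1 [symmetric] is_interval_1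
proof (intro ballI allI impI)
  fix a b u
  assume a: "a \<in> snr_set D_x \<eta> \<beta> d_v \<rho> \<mu> x y t"
    and b: "b \<in> snr_set D_x \<eta> \<beta> d_v \<rho> \<mu> x y t" and u: "a \<le> u \<and> u \<le> b"
  \<comment> \<open>Moving from u away from x, one reaches a or b: if u lies left of x, then a is at
    least as far from x as u is; otherwise b is.\<close>
  from u consider "\<bar>x - u\<bar> \<le> \<bar>x - a\<bar>" | "\<bar>x - u\<bar> \<le> \<bar>x - b\<bar>"
    by linarith
  then have "t \<le> avg_snr \<eta> \<beta> d_v \<rho> \<mu> x y u"
  proof cases
    case 1
    from avg_snr_antimono_dist[OF assms this] a show ?thesis
      unfolding snr_set_def by (blast intro: order_trans)
  next
    case 2
    from avg_snr_antimono_dist[OF assms this] b show ?thesis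
      unfolding snr_set_def by (blast intro: order_trans)
  qed
  then show "u \<in> snr_set D_x \<eta> \<beta> d_v \<rho> \<mu> x y t"
    using a b u by (simp add: snr_set_def)
qed

lemma snr_set_antimono:
  "s \<le> t \<Longrightarrow> snr_set D_x \<eta> \<beta> d_v \<rho> \<mu> x y t \<subseteq> snr_set D_x \<eta> \<beta> d_v \<rho> \<mu> x y s"
  by (auto simp: snr_set_def)

theorem proposition1:
  fixes D_x D_y d_v \<eta> \<beta> :: real
    and M :: nat
    and \<rho> \<mu> x y :: "nat \<Rightarrow> real"
  assumes "D_x > 0" and "D_y > 0" and "d_v > 0" and "\<eta> > 0"
    and "0 \<le> \<beta>" and "\<beta> \<le> 1"
    and "M \<ge> 1"
    and "\<And>m. m \<in> {1..M} \<Longrightarrow> \<rho> m > 0"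
    and "\<And>m. m \<in> {1..M} \<Longrightarrow> x m \<in> {0..D_x}"
    and "\<And>m. m \<in> {1..M} \<Longrightarrow> y m \<in> {- D_y / 2..D_y / 2}"
  shows "(\<forall>m\<in>{1..M}. \<forall>t>0.
            is_closed_interval (snr_set D_x \<eta> \<beta> d_v (\<rho> m) (\<mu> m) (x m) (y m) t) \<or>
            snr_set D_x \<eta> \<beta> d_v (\<rho> m) (\<mu> m) (x m) (y m) t = {}) \<and>
         (\<forall>t>0.
            is_closed_interval (feasible_set D_x \<eta> \<beta> d_v M \<rho> \<mu> x y t) \<or>
            feasible_set D_x \<eta> \<beta> d_v M \<rho> \<mu> x y t = {}) \<and>
         (\<forall>t1>0. \<forall>t2>0. t1 < t2 \<longrightarrow>
            feasible_set D_x \<eta> \<beta> d_v M \<rho> \<mu> x y t1 \<supseteq> feasible_set D_x \<eta> \<beta> d_v M \<rho> \<mu> x y t2)"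
proof (intro conjI ballI allI impI)
  have convex: "convex (snr_set D_x \<eta> \<beta> d_v (\<rho> m) (\<mu> m) (x m) (y m) t)"
    if "m \<in> {1..M}" for m t
    using assms(3-5) assms(8)[OF that] by (intro convex_snr_set) simp_all
  have compact: "compact (snr_set D_x \<eta> \<beta> d_v (\<rho> m) (\<mu> m) (x m) (y m) t)" for m t
    using assms(3) by (rule compact_snr_set)
  show "is_closed_interval (snr_set D_x \<eta> \<beta> d_v (\<rho> m) (\<mu> m) (x m) (y m) t) \<or>
      snr_set D_x \<eta> \<beta> d_v (\<rho> m) (\<mu> m) (x m) (y m) t = {}"
    if "m \<in> {1..M}" for m t
    unfolding closed_interval_or_empty_iff using convex[OF that] compact ..
  show "is_closed_interval (feasible_set D_x \<eta> \<beta> d_v M \<rho> \<mu> x y t) \<or>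
      feasible_set D_x \<eta> \<beta> d_v M \<rho> \<mu> x y t = {}" for t
    unfolding closed_interval_or_empty_iff
  proof
    show "convex (feasible_set D_x \<eta> \<beta> d_v M \<rho> \<mu> x y t)"
      unfolding feasible_set_def by (intro convex_INT convex)
    \<comment> \<open>An intersection over no users would be the whole line, which is not compact;
      this is where \<open>M \<ge> 1\<close> enters.\<close>
    have "{1..M} \<noteq> {}"
      using assms(7) by simp
    then show "compact (feasible_set D_x \<eta> \<beta> d_v M \<rho> \<mu> x y t)"
      unfolding feasible_set_def using compact by (intro compact_Inter) auto
  qed
  show "feasible_set D_x \<eta> \<beta> d_v M \<rho> \<mu> x y t2 \<subseteq> feasible_set D_x \<eta> \<beta> d_v M \<rho> \<mu> x y t1"
    if "t1 < t2" for t1 t2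
    unfolding feasible_set_def
    by (intro INF_superset_mono subset_refl snr_set_antimono less_imp_le that)
qed

end
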